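(* Let $r_1,r_2,\rho_1,\rho_2$ be real numbers with $r_1+r_2-\rho_1-\rho_2\notin\{1,2,3,\dots\}$, and let $P_n$, $X$, $Y$, $Z$, $\omega_2,\omega_3$ be as defined in the context. Put $$J_+=(Y+Z)(X-\tfrac12)-\frac{\omega_2+\omega_3}{2},\qquad J_-=(Y-Z)(X+\tfrac12)+\frac{\omega_2-\omega_3}{2}.$$ Then $\{X,J_+\}=J_+$, $\{X,J_-\}=-J_-$, and the Bannai-Ito polynomials $P_n$ satisfy the structure relations $$J_+P_n=\begin{cases}\alpha^{(0)}_nP_{n-1},& n\text{ even},\\ \alpha^{(1)}_nP_{n+1},& n\text{ odd},\end{cases}\qquad J_-P_n=\begin{cases}\beta^{(0)}_nP_{n+1},& n\text{ even},\\ \beta^{(1)}_nP_{n-1},& n\text{ odd},\end{cases}$$ (with $J_+P_0=0$), where $$\alpha_n^{(0)}=\frac{2n(\rho_1+\rho_2+n/2)(r_1+r_2-n/2)(r_1+r_2-\rho_1-\rho_2-n/2)}{r_1+r_2-\rho_1-\rho_2-n}\ (n\geq 2),\qquad \alpha^{(1)}_n=4(r_1+r_2-\rho_1-\rho_2-n-1),$$ $$\beta^{(0)}_n=-4(r_1+r_2-\rho_1-\rho_2-n-1),\qquad \beta^{(1)}_n=\frac{4(\rho_1-r_1+n/2)(\rho_1-r_2+n/2)(\rho_2-r_1+n/2)(\rho_2-r_2+n/2)}{\rho_1+\rho_2-r_1-r_2+n}.$$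
   Context: For real parameters $r_1,r_2,\rho_1,\rho_2$ the Dunkl shift operator $L$ acts on polynomials by $$L=\frac{(x-\rho_1)(x-\rho_2)}{2x}(I-R)+\frac{(x-r_1+1/2)(x-r_2+1/2)}{2x+1}(T^+R-I),$$ where $Rf(x)=f(-x)$, $T^+Rf(x)=f(-x-1)$. It maps polynomials to polynomials and $Lx^n=\lambda_nx^n+O(x^{n-1})$ with $\lambda_n=n/2$ for even $n$ and $\lambda_n=r_1+r_2-\rho_1-\rho_2-(n+1)/2$ for odd $n$. If $r_1+r_2-\rho_1-\rho_2\notin\{1,2,\dots\}$, the $\lambda_n$ are pairwise distinct, and $P_n$ (Bannai-Ito polynomial) denotes the unique monic polynomial of degree $n$ with $LP_n=\lambda_nP_n$. The operators $X,Y,Z$ on polynomials are $X=2L+\kappa$ with $\kappa=\rho_1+\rho_2-r_1-r_2+\frac12$, $Y=2x+\frac12$ (multiplication), and $$Z=\frac{r_1r_2}{x+1/2}+\frac{\rho_1\rho_2}{x}-\frac{(x-\rho_1)(x-\rho_2)}{x}R-\frac{(x-r_1+1/2)(x-r_2+1/2)}{x+1/2}T^+R.$$ The constants are $\omega_2=2(\rho_1^2+\rho_2^2-r_1^2-r_2^2)$, $\omega_3=4(\rho_1\rho_2-r_1r_2)$. $\{A,B\}=AB+BA$. *)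

theory Defs
  imports "HOL-Computational_Algebra.Polynomial"
begin

(* The coefficients of L and Z have poles at 0 and -1/2, so these operators are given pointwise
   away from the two poles; the value on a polynomial is the polynomial with these values.
   The lemmas poly_dunkl_L and poly_BI_Z show that it exists. *)
definition poly_off_poles :: "(real \<Rightarrow> real) \<Rightarrow> real poly" where
  "poly_off_poles g = (THE q. \<forall>x. x \<noteq> 0 \<longrightarrow> x \<noteq> - 1/2 \<longrightarrow> poly q x = g x)"

definition dunkl_L :: "real \<Rightarrow> real \<Rightarrow> real \<Rightarrow> real \<Rightarrow> real poly \<Rightarrow> real poly" where
  "dunkl_L r1 r2 \<rho>1 \<rho>2 f = poly_off_poles (\<lambda>x.
     (x - \<rho>1) * (x - \<rho>2) / (2 * x) * (poly f x - poly f (- x))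
     + (x - r1 + 1/2) * (x - r2 + 1/2) / (2 * x + 1) * (poly f (- x - 1) - poly f x))"

definition BI_eigenvalue :: "real \<Rightarrow> real \<Rightarrow> real \<Rightarrow> real \<Rightarrow> nat \<Rightarrow> real" where
  "BI_eigenvalue r1 r2 \<rho>1 \<rho>2 n =
     (if even n then real n / 2 else r1 + r2 - \<rho>1 - \<rho>2 - (real n + 1) / 2)"

definition BI_poly :: "real \<Rightarrow> real \<Rightarrow> real \<Rightarrow> real \<Rightarrow> nat \<Rightarrow> real poly" where
  "BI_poly r1 r2 \<rho>1 \<rho>2 n =
     (THE p. lead_coeff p = 1 \<and> degree p = n \<and>
             dunkl_L r1 r2 \<rho>1 \<rho>2 p = smult (BI_eigenvalue r1 r2 \<rho>1 \<rho>2 n) p)"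

definition BI_X :: "real \<Rightarrow> real \<Rightarrow> real \<Rightarrow> real \<Rightarrow> real poly \<Rightarrow> real poly" where
  "BI_X r1 r2 \<rho>1 \<rho>2 f =
     smult 2 (dunkl_L r1 r2 \<rho>1 \<rho>2 f) + smult (\<rho>1 + \<rho>2 - r1 - r2 + 1/2) f"

definition BI_Y :: "real poly \<Rightarrow> real poly" where
  "BI_Y f = [:1/2, 2:] * f"

definition BI_Z :: "real \<Rightarrow> real \<Rightarrow> real \<Rightarrow> real \<Rightarrow> real poly \<Rightarrow> real poly" where
  "BI_Z r1 r2 \<rho>1 \<rho>2 f = poly_off_poles (\<lambda>x.
     r1 * r2 / (x + 1/2) * poly f x + \<rho>1 * \<rho>2 / x * poly f x
     - (x - \<rho>1) * (x - \<rho>2) / x * poly f (- x)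
     - (x - r1 + 1/2) * (x - r2 + 1/2) / (x + 1/2) * poly f (- x - 1))"

definition BI_omega2 :: "real \<Rightarrow> real \<Rightarrow> real \<Rightarrow> real \<Rightarrow> real" where
  "BI_omega2 r1 r2 \<rho>1 \<rho>2 = 2 * (\<rho>1\<^sup>2 + \<rho>2\<^sup>2 - r1\<^sup>2 - r2\<^sup>2)"

definition BI_omega3 :: "real \<Rightarrow> real \<Rightarrow> real \<Rightarrow> real \<Rightarrow> real" where
  "BI_omega3 r1 r2 \<rho>1 \<rho>2 = 4 * (\<rho>1 * \<rho>2 - r1 * r2)"

definition J_plus :: "real \<Rightarrow> real \<Rightarrow> real \<Rightarrow> real \<Rightarrow> real poly \<Rightarrow> real poly" where
  "J_plus r1 r2 \<rho>1 \<rho>2 f =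
     (let g = BI_X r1 r2 \<rho>1 \<rho>2 f - smult (1/2) f
      in BI_Y g + BI_Z r1 r2 \<rho>1 \<rho>2 g
         - smult ((BI_omega2 r1 r2 \<rho>1 \<rho>2 + BI_omega3 r1 r2 \<rho>1 \<rho>2) / 2) f)"

definition J_minus :: "real \<Rightarrow> real \<Rightarrow> real \<Rightarrow> real \<Rightarrow> real poly \<Rightarrow> real poly" where
  "J_minus r1 r2 \<rho>1 \<rho>2 f =
     (let g = BI_X r1 r2 \<rho>1 \<rho>2 f + smult (1/2) f
      in BI_Y g - BI_Z r1 r2 \<rho>1 \<rho>2 g
         + smult ((BI_omega2 r1 r2 \<rho>1 \<rho>2 - BI_omega3 r1 r2 \<rho>1 \<rho>2) / 2) f)"

definition anticomm ::
    "(real poly \<Rightarrow> real poly) \<Rightarrow> (real poly \<Rightarrow> real poly) \<Rightarrow> real poly \<Rightarrow> real poly" where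
  "anticomm A B = (\<lambda>f. A (B f) + B (A f))"

definition alpha0 :: "real \<Rightarrow> real \<Rightarrow> real \<Rightarrow> real \<Rightarrow> nat \<Rightarrow> real" where
  "alpha0 r1 r2 \<rho>1 \<rho>2 n =
     2 * real n * (\<rho>1 + \<rho>2 + real n / 2) * (r1 + r2 - real n / 2)
       * (r1 + r2 - \<rho>1 - \<rho>2 - real n / 2)
     / (r1 + r2 - \<rho>1 - \<rho>2 - real n)"

definition alpha1 :: "real \<Rightarrow> real \<Rightarrow> real \<Rightarrow> real \<Rightarrow> nat \<Rightarrow> real" where
  "alpha1 r1 r2 \<rho>1 \<rho>2 n = 4 * (r1 + r2 - \<rho>1 - \<rho>2 - real n - 1)"

definition beta0 :: "real \<Rightarrow> real \<Rightarrow> real \<Rightarrow> real \<Rightarrow> nat \<Rightarrow> real" where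
  "beta0 r1 r2 \<rho>1 \<rho>2 n = - 4 * (r1 + r2 - \<rho>1 - \<rho>2 - real n - 1)"

definition beta1 :: "real \<Rightarrow> real \<Rightarrow> real \<Rightarrow> real \<Rightarrow> nat \<Rightarrow> real" where
  "beta1 r1 r2 \<rho>1 \<rho>2 n =
     4 * (\<rho>1 - r1 + real n / 2) * (\<rho>1 - r2 + real n / 2)
       * (\<rho>2 - r1 + real n / 2) * (\<rho>2 - r2 + real n / 2)
     / (\<rho>1 + \<rho>2 - r1 - r2 + real n)"

lemma poly_off_poles_eqI:
  assumes "\<And>x. x \<noteq> 0 \<Longrightarrow> x \<noteq> - 1/2 \<Longrightarrow> poly q x = g x"
  shows "poly_off_poles g = q"
  unfolding poly_off_poles_def
proof (rule the_equality)
  show "\<forall>x. x \<noteq> 0 \<longrightarrow> x \<noteq> - 1/2 \<longrightarrow> poly q x = g x"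
    using assms by blast
next
  fix p assume p: "\<forall>x. x \<noteq> 0 \<longrightarrow> x \<noteq> - 1/2 \<longrightarrow> poly p x = g x"
  show "p = q"
  proof (rule ccontr)
    assume "p \<noteq> q"
    then have "finite {x. poly (p - q) x = 0}"
      by (intro poly_roots_finite) simp
    moreover have "UNIV - {0, - 1/2} \<subseteq> {x. poly (p - q) x = 0}"
      using p assms by auto
    ultimately have "finite (UNIV - {0, - 1/2 :: real})"
      by (rule finite_subset[rotated])
    then show False
      by (simp add: infinite_UNIV_char_0)
  qed
qed

lemma poly_root_factor:
  fixes p :: "real poly"
  assumes "poly p a = 0"
  shows "\<exists>q. \<forall>x. poly p x = (x - a) * poly q x"
proof -
  from assms obtain q where "p = [:- a, 1:] * q"
    by (auto simp: poly_eq_0_iff_dvd dvd_def)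
  then have "poly p x = (x - a) * poly q x" for x
    unfolding \<open>p = _\<close> poly_mult by simp
  then show ?thesis by blast
qed

lemma poly_dunkl_L:
  assumes "x \<noteq> 0" "x \<noteq> - 1/2"
  shows "poly (dunkl_L r1 r2 \<rho>1 \<rho>2 f) x =
     (x - \<rho>1) * (x - \<rho>2) / (2 * x) * (poly f x - poly f (- x))
     + (x - r1 + 1/2) * (x - r2 + 1/2) / (2 * x + 1) * (poly f (- x - 1) - poly f x)"
proof -
  have "poly (f - pcompose f [:0, -1:]) 0 = 0"
    by (simp add: poly_pcompose)
  from poly_root_factor[OF this] obtain a where
    a: "\<And>x. poly (f - pcompose f [:0, -1:]) x = (x - 0) * poly a x" by blast
  have "poly (pcompose f [:-1, -1:] - f) (- 1/2) = 0"
    by (simp add: poly_pcompose)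
  from poly_root_factor[OF this] obtain b where
    b: "\<And>x. poly (pcompose f [:-1, -1:] - f) x = (x - (- 1/2)) * poly b x" by blast
  have a': "poly f x - poly f (- x) = x * poly a x" for x
    using a[of x] by (simp add: poly_pcompose)
  have m: "- x - 1 = - 1 - x" for x :: real
    by simp
  have b': "poly f (- x - 1) - poly f x = (2 * x + 1) * (poly b x / 2)" for x
    using b[of x] unfolding m by (simp add: poly_pcompose algebra_simps)
  have q: "(x - \<rho>1) * (x - \<rho>2) / (2 * x) * (poly f x - poly f (- x))
     + (x - r1 + 1/2) * (x - r2 + 1/2) / (2 * x + 1) * (poly f (- x - 1) - poly f x)
     = poly (smult (1/2) ([:- \<rho>1, 1:] * [:- \<rho>2, 1:] * a
              + [:1/2 - r1, 1:] * [:1/2 - r2, 1:] * b)) x"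
    if "x \<noteq> 0" "x \<noteq> - 1/2" for x
  proof -
    have nz: "2 * x + 1 \<noteq> 0" using that by auto
    have 1: "(x - \<rho>1) * (x - \<rho>2) / (2 * x) * (x * poly a x) = (x - \<rho>1) * (x - \<rho>2) * poly a x / 2"
      using that by simp
    have 2: "(x - r1 + 1/2) * (x - r2 + 1/2) / (2 * x + 1) * ((2 * x + 1) * (poly b x / 2))
        = (x - r1 + 1/2) * (x - r2 + 1/2) * poly b x / 2"
      using nz by simp
    show ?thesis
      unfolding a' b' 1 2 by (simp add: field_simps)
  qed
  have "dunkl_L r1 r2 \<rho>1 \<rho>2 f = smult (1/2) ([:- \<rho>1, 1:] * [:- \<rho>2, 1:] * a
              + [:1/2 - r1, 1:] * [:1/2 - r2, 1:] * b)"
    unfolding dunkl_L_def by (rule poly_off_poles_eqI) (rule q[symmetric])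
  then show ?thesis
    using q[OF assms] by simp
qed

lemma poly_BI_Z:
  assumes "x \<noteq> 0" "x \<noteq> - 1/2"
  shows "poly (BI_Z r1 r2 \<rho>1 \<rho>2 f) x =
     r1 * r2 / (x + 1/2) * poly f x + \<rho>1 * \<rho>2 / x * poly f x
     - (x - \<rho>1) * (x - \<rho>2) / x * poly f (- x)
     - (x - r1 + 1/2) * (x - r2 + 1/2) / (x + 1/2) * poly f (- x - 1)"
proof -
  have "poly (smult (\<rho>1 * \<rho>2) f - [:- \<rho>1, 1:] * [:- \<rho>2, 1:] * pcompose f [:0, -1:]) 0 = 0"
    by (simp add: poly_pcompose)
  from poly_root_factor[OF this] obtain a where
    a: "\<And>x. poly (smult (\<rho>1 * \<rho>2) f
      - [:- \<rho>1, 1:] * [:- \<rho>2, 1:] * pcompose f [:0, -1:]) x = (x - 0) * poly a x" by blast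
  have "poly (smult (r1 * r2) f
      - [:1/2 - r1, 1:] * [:1/2 - r2, 1:] * pcompose f [:-1, -1:]) (- 1/2) = 0"
    by (simp add: poly_pcompose algebra_simps)
  from poly_root_factor[OF this] obtain b where
    b: "\<And>x. poly (smult (r1 * r2) f
      - [:1/2 - r1, 1:] * [:1/2 - r2, 1:] * pcompose f [:-1, -1:]) x
      = (x - (- 1/2)) * poly b x" by blast
  have a': "\<rho>1 * \<rho>2 * poly f x - (x - \<rho>1) * (x - \<rho>2) * poly f (- x) = x * poly a x" for x
    using a[of x] by (simp add: poly_pcompose algebra_simps)
  have m: "- x - 1 = - 1 - x" for x :: real
    by simp
  have b': "r1 * r2 * poly f x - (x - r1 + 1/2) * (x - r2 + 1/2) * poly f (- x - 1)
      = (x + 1/2) * poly b x" for x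
    using b[of x] unfolding m by (simp add: poly_pcompose algebra_simps)
  have q: "r1 * r2 / (x + 1/2) * poly f x + \<rho>1 * \<rho>2 / x * poly f x
     - (x - \<rho>1) * (x - \<rho>2) / x * poly f (- x)
     - (x - r1 + 1/2) * (x - r2 + 1/2) / (x + 1/2) * poly f (- x - 1) = poly (a + b) x"
    if "x \<noteq> 0" "x \<noteq> - 1/2" for x
  proof -
    have nz: "x + 1/2 \<noteq> 0" using that by auto
    have "poly a x = (\<rho>1 * \<rho>2 * poly f x - (x - \<rho>1) * (x - \<rho>2) * poly f (- x)) / x"
      using that by (simp add: a')
    moreover have "poly b x =
        (r1 * r2 * poly f x - (x - r1 + 1/2) * (x - r2 + 1/2) * poly f (- x - 1)) / (x + 1/2)"
      unfolding b' using nz by (metis nonzero_mult_div_cancel_left)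
    ultimately show ?thesis
      by (simp only: poly_add) (simp add: diff_divide_distrib)
  qed
  have "BI_Z r1 r2 \<rho>1 \<rho>2 f = a + b"
    unfolding BI_Z_def by (rule poly_off_poles_eqI) (rule q[symmetric])
  then show ?thesis
    using q[OF assms] by simp
qed

end

theory Submission
  imports Defs
begin

text \<open>
  All operators are built from one reflection operator
  \<open>D = (a b - (y - a) (y - b) R) / y\<close>, where \<open>R\<close> sends \<open>y = x + h\<close> to \<open>- y\<close>.  It satisfies
  \<open>{D, y} = 2 a b\<close> and \<open>D\<^sup>2 = a\<^sup>2 + b\<^sup>2 - y\<^sup>2\<close>.  Taking \<open>D\<^sub>\<rho>\<close> with \<open>h = 0\<close> and the parameters
  \<open>\<rho>\<^sub>1, \<rho>\<^sub>2\<close>, and \<open>D\<^sub>r\<close> with \<open>h = 1/2\<close> and the parameters \<open>r\<^sub>1, r\<^sub>2\<close>, one finds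
  \<open>X = D\<^sub>\<rho> - D\<^sub>r\<close> and \<open>Z = D\<^sub>\<rho> + D\<^sub>r\<close>.  Hence \<open>{X, Y} = Z + \<omega>\<^sub>3\<close> and \<open>{X, Z} = Y + \<omega>\<^sub>2\<close>
  (\<open>BI_X_Y\<close>, \<open>BI_X_Z\<close>), the squares of \<open>Y \<plusminus> Z\<close> are polynomials in \<open>X\<close> (\<open>BI_W_square\<close>), and the
  relations \<open>{X, J} = \<plusminus> J\<close> follow formally (\<open>anticomm_X_J\<close>).

  If \<open>X p = \<lambda> p\<close>, then \<open>J p\<close> is an eigenvector of \<open>X\<close> for \<open>\<plusminus>1 - \<lambda>\<close>, or zero.  Put
  \<open>s = r\<^sub>1 + r\<^sub>2 - \<rho>\<^sub>1 - \<rho>\<^sub>2\<close>; the eigenvalue of \<open>P\<^sub>n\<close> is \<open>(- 1)\<^sup>n (n + 1/2 - s)\<close>, so depending on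
  the parity of \<open>n\<close> one of \<open>J\<^sub>+\<close>, \<open>J\<^sub>-\<close> leads to the eigenvalue with index \<open>n + 1\<close> and the other to
  that with index \<open>n - 1\<close>.  In the raising case the leading coefficient of \<open>J P\<^sub>n\<close> is
  \<open>\<plusminus>4 (s - n - 1)\<close>, which is nonzero by the hypothesis on \<open>s\<close>; this yields the raising formulas
  and also the existence of the \<open>P\<^sub>n\<close> by induction from \<open>P\<^sub>0 = 1\<close>
  (\<open>BI_J_raises_eigenpoly\<close>).  Uniqueness holds because the eigenvalues are distinct and \<open>X\<close> is
  triangular (\<open>BI_eigenspace\<close>).

  The lowering formulas come from \<open>J\<^sup>2\<close>, which is an explicit product of four linear factors in \<open>X\<close>
  (\<open>BI_J_square\<close>): if \<open>J P\<^sub>n = k P\<^sub>n\<^sub>+\<^sub>1\<close>, then \<open>J P\<^sub>n\<^sub>+\<^sub>1 = J\<^sup>2 P\<^sub>n / k\<close>.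
\<close>

section \<open>The basic reflection operator\<close>

text \<open>With \<open>y = x + h\<close> and the reflection \<open>R\<^sub>h f(x) = f(- x - 2h)\<close>, which sends \<open>y\<close> to
  \<open>- y\<close>, this is the operator \<open>(a b - (y - a) (y - b) R\<^sub>h) / y\<close>.  The numerator vanishes at
  \<open>y = 0\<close>, so the division is exact.\<close>

definition refl_op :: "real \<Rightarrow> real \<Rightarrow> real \<Rightarrow> real poly \<Rightarrow> real poly" where
  "refl_op h a b f =
     (smult (a * b) f - [:h - a, 1:] * [:h - b, 1:] * pcompose f [:- 2 * h, - 1:]) div [:h, 1:]"

lemma refl_op_mult:
  "[:h, 1:] * refl_op h a b f =
     smult (a * b) f - [:h - a, 1:] * [:h - b, 1:] * pcompose f [:- 2 * h, - 1:]"
proof -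
  have "[:- (- h), 1:] dvd
      smult (a * b) f - [:h - a, 1:] * [:h - b, 1:] * pcompose f [:- 2 * h, - 1:]"
    unfolding poly_eq_0_iff_dvd[symmetric] by (simp add: poly_pcompose algebra_simps)
  then show ?thesis
    unfolding refl_op_def minus_minus by (rule dvd_mult_div_cancel)
qed

lemma refl_op_eqI:
  assumes "[:h, 1:] * g =
    smult (a * b) f - [:h - a, 1:] * [:h - b, 1:] * pcompose f [:- 2 * h, - 1:]"
  shows "refl_op h a b f = g"
proof -
  have "[:h, 1:] * refl_op h a b f = [:h, 1:] * g"
    using assms refl_op_mult by simp
  then show ?thesis
    by (metis mult_cancel_left one_neq_zero pCons_eq_0_iff)
qed

lemma poly_refl_op:
  assumes "x + h \<noteq> 0"
  shows "poly (refl_op h a b f) x =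
    (a * b * poly f x - (x + h - a) * (x + h - b) * poly f (- x - 2 * h)) / (x + h)"
proof -
  have "poly ([:h, 1:] * refl_op h a b f) x =
      poly (smult (a * b) f - [:h - a, 1:] * [:h - b, 1:] * pcompose f [:- 2 * h, - 1:]) x"
    by (simp only: refl_op_mult)
  then have "(x + h) * poly (refl_op h a b f) x =
      a * b * poly f x - (x + h - a) * (x + h - b) * poly f (- x - 2 * h)"
    by (simp add: poly_pcompose algebra_simps)
  then show ?thesis
    using assms by (simp add: field_simps)
qed

lemma refl_op_add: "refl_op h a b (f + g) = refl_op h a b f + refl_op h a b g"
  by (rule refl_op_eqI)
    (simp only: distrib_left[of _ "refl_op h a b f"] refl_op_mult pcompose_add smult_add_right,
      simp only: algebra_simps)

lemma refl_op_smult: "refl_op h a b (smult c f) = smult c (refl_op h a b f)"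
proof (rule refl_op_eqI)
  show "[:h, 1:] * smult c (refl_op h a b f) = smult (a * b) (smult c f)
      - [:h - a, 1:] * [:h - b, 1:] * pcompose (smult c f) [:- 2 * h, - 1:]"
    by (simp only: mult_smult_right refl_op_mult pcompose_smult smult_diff_right smult_smult
        mult.commute)
qed

lemma refl_op_diff: "refl_op h a b (f - g) = refl_op h a b f - refl_op h a b g"
  using refl_op_add[of h a b "f - g" g] by (simp add: algebra_simps)

text \<open>The reflection part of the operator anticommutes with \<open>y\<close>, so only the diagonal part
  \<open>a b / y\<close> contributes to the anticommutator.\<close>

lemma refl_op_anticomm_mult:
  "refl_op h a b ([:h, 1:] * f) = smult (2 * a * b) f - [:h, 1:] * refl_op h a b f"
proof (rule refl_op_eqI)
  have refl: "pcompose [:h, 1:] [:- 2 * h, - 1:] = - [:h, 1:]"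
    by (simp add: pcompose_pCons)
  show "[:h, 1:] * (smult (2 * a * b) f - [:h, 1:] * refl_op h a b f) =
      smult (a * b) ([:h, 1:] * f)
      - [:h - a, 1:] * [:h - b, 1:] * pcompose ([:h, 1:] * f) [:- 2 * h, - 1:]"
    unfolding refl_op_mult pcompose_mult refl
    by (rule poly_ext) (simp add: algebra_simps)
qed

text \<open>In the square the terms containing one reflection cancel, as \<open>a b / y\<close> is odd under \<open>y \<mapsto> - y\<close>.
  What remains is \<open>(a\<^sup>2 b\<^sup>2 - (y\<^sup>2 - a\<^sup>2) (y\<^sup>2 - b\<^sup>2)) / y\<^sup>2\<close>.\<close>

lemma refl_op_square:
  "refl_op h a b (refl_op h a b f) = smult (a\<^sup>2 + b\<^sup>2) f - [:h, 1:] * ([:h, 1:] * f)"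
proof (rule refl_op_eqI)
  define D where "D = refl_op h a b f"
  define R where "R = (\<lambda>g :: real poly. pcompose g [:- 2 * h, - 1:])"
  have yD: "[:h, 1:] * D = smult (a * b) f - [:h - a, 1:] * [:h - b, 1:] * R f"
    unfolding D_def R_def by (rule refl_op_mult)
  have "R ([:h, 1:] * D) =
      R (smult (a * b) f - [:h - a, 1:] * [:h - b, 1:] * R f)"
    by (simp only: yD)
  \<comment> \<open>Reflecting \<open>yD\<close> turns \<open>y\<close> into \<open>- y\<close> and \<open>R f\<close> back into \<open>f\<close>.\<close>
  then have yRD: "[:h, 1:] * R D = [:h + a, 1:] * [:h + b, 1:] * f - smult (a * b) (R f)"
    unfolding R_def poly_eq_poly_eq_iff[symmetric] fun_eq_iff
    by (simp add: poly_pcompose algebra_simps)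
  \<comment> \<open>One more factor \<open>y\<close> than required, so that \<open>yD\<close> and \<open>yRD\<close> both apply.\<close>
  have "[:h, 1:] * ([:h, 1:] * (smult (a\<^sup>2 + b\<^sup>2) f - [:h, 1:] * ([:h, 1:] * f))) =
      smult (a * b) ([:h, 1:] * D) - [:h - a, 1:] * [:h - b, 1:] * ([:h, 1:] * R D)"
    unfolding yD yRD
    by (rule poly_ext) (simp add: algebra_simps power2_eq_square)
  also have "\<dots> = [:h, 1:] * (smult (a * b) D - [:h - a, 1:] * [:h - b, 1:] * R D)"
    by (rule poly_ext) (simp add: algebra_simps)
  finally show "[:h, 1:] * (smult (a\<^sup>2 + b\<^sup>2) f - [:h, 1:] * ([:h, 1:] * f)) =
      smult (a * b) (refl_op h a b f)
      - [:h - a, 1:] * [:h - b, 1:] * pcompose (refl_op h a b f) [:- 2 * h, - 1:]"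
    unfolding D_def R_def by (metis mult_cancel_left one_neq_zero pCons_eq_0_iff)
qed

lemma refl_op_one: "refl_op h a b 1 = [:a + b - h, - 1:]"
  by (rule refl_op_eqI) (rule poly_ext, simp add: poly_pcompose algebra_simps)

lemma refl_op_lead:
  assumes f: "f \<noteq> 0"
  shows "degree (refl_op h a b f) = Suc (degree f)"
    and "lead_coeff (refl_op h a b f) = - ((- 1) ^ degree f * lead_coeff f)"
proof -
  define g where "g = [:h - a, 1:] * [:h - b, 1:] * pcompose f [:- 2 * h, - 1:]"
  have comp: "pcompose f [:- 2 * h, - 1:] \<noteq> 0"
    using f by (simp add: pcompose_eq_0_iff)
  have deg_g: "degree g = Suc (Suc (degree f))"
    unfolding g_def using comp by (subst degree_mult_eq, force, force)+ (simp add: degree_pcompose)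
  have lc_g: "lead_coeff g = (- 1) ^ degree f * lead_coeff f"
    unfolding g_def by (simp only: lead_coeff_mult, subst lead_coeff_comp) (simp_all add: mult.commute)
  have eq: "[:h, 1:] * refl_op h a b f = smult (a * b) f - g"
    unfolding g_def by (rule refl_op_mult)
  have small: "degree (smult (a * b) f) < degree (- g)"
    using deg_g by simp
  have "degree (smult (a * b) f - g) = Suc (Suc (degree f))"
    using degree_add_eq_right[OF small] deg_g by simp
  then have deg: "degree ([:h, 1:] * refl_op h a b f) = Suc (Suc (degree f))"
    by (simp only: eq)
  then have nz: "refl_op h a b f \<noteq> 0"
    by (metis degree_0 mult_zero_right nat.distinct(1))
  show deg': "degree (refl_op h a b f) = Suc (degree f)"
    using deg nz by (subst (asm) degree_mult_eq) auto
  have "lead_coeff (refl_op h a b f) = lead_coeff ([:h, 1:] * refl_op h a b f)"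
    by (simp only: lead_coeff_mult) simp
  also have "\<dots> = lead_coeff (- g)"
    unfolding eq using lead_coeff_add_le[OF small] by simp
  also have "\<dots> = - ((- 1) ^ degree f * lead_coeff f)"
    using lc_g by simp
  finally show "lead_coeff (refl_op h a b f) = - ((- 1) ^ degree f * lead_coeff f)" .
qed

lemma refl_op_Y:
  "refl_op h a b (BI_Y f) =
     smult (4 * a * b) f + smult (1 - 4 * h) (refl_op h a b f) - BI_Y (refl_op h a b f)"
proof -
  have Y: "BI_Y g = smult 2 ([:h, 1:] * g) + smult (1/2 - 2 * h) g" for g
    unfolding BI_Y_def by (rule poly_ext) (simp add: algebra_simps)
  show ?thesis
    unfolding Y refl_op_add refl_op_smult refl_op_anticomm_mult
    by (rule poly_ext) (simp add: algebra_simps)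
qed

section \<open>The Bannai-Ito relations\<close>

lemma poly_eqI_off_poles:
  fixes p q :: "real poly"
  assumes "\<And>x. x \<noteq> 0 \<Longrightarrow> x \<noteq> - 1/2 \<Longrightarrow> poly p x = poly q x"
  shows "p = q"
  by (metis assms poly_off_poles_eqI)

context
  fixes r1 r2 \<rho>1 \<rho>2 :: real
begin

abbreviation (input) "X \<equiv> BI_X r1 r2 \<rho>1 \<rho>2"
abbreviation (input) "Y \<equiv> BI_Y"
abbreviation (input) "Z \<equiv> BI_Z r1 r2 \<rho>1 \<rho>2"
abbreviation (input) "D\<^sub>\<rho> \<equiv> refl_op 0 \<rho>1 \<rho>2"
abbreviation (input) "D\<^sub>r \<equiv> refl_op (1/2) r1 r2"
abbreviation (input) "s \<equiv> r1 + r2 - \<rho>1 - \<rho>2"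

text \<open>This decomposition and its companion for \<open>Z\<close> reduce all relations between \<open>X\<close>, \<open>Y\<close> and \<open>Z\<close> to
  those of a single reflection operator with \<open>y\<close>.  It holds because
  \<open>(y - a) (y - b) / y = y - a - b + a b / y\<close>: the polynomial parts of the two coefficients of
  \<open>2 L\<close> differ by exactly the constant that \<open>X\<close> adds.\<close>

lemma BI_X_refl_op: "X f = D\<^sub>\<rho> f - D\<^sub>r f"
proof (rule poly_eqI_off_poles)
  fix x :: real assume x: "x \<noteq> 0" "x \<noteq> - 1/2"
  then have "x + 1/2 \<noteq> 0" by auto
  then show "poly (X f) x = poly (D\<^sub>\<rho> f - D\<^sub>r f) x"
    unfolding BI_X_def using x
    by (simp add: poly_dunkl_L poly_refl_op divide_simps) algebra
qed

lemma BI_Z_refl_op: "Z f = D\<^sub>\<rho> f + D\<^sub>r f"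
proof (rule poly_eqI_off_poles)
  fix x :: real assume x: "x \<noteq> 0" "x \<noteq> - 1/2"
  then have "x + 1/2 \<noteq> 0" by auto
  then show "poly (Z f) x = poly (D\<^sub>\<rho> f + D\<^sub>r f) x"
    using x
    by (simp add: poly_BI_Z poly_refl_op divide_simps) algebra
qed

lemma BI_X_add: "X (f + g) = X f + X g"
  and BI_X_diff: "X (f - g) = X f - X g"
  and BI_X_smult: "X (smult c f) = smult c (X f)"
  unfolding BI_X_refl_op refl_op_add refl_op_diff refl_op_smult
  by (simp_all add: smult_diff_right)

lemma BI_X_Y: "X (Y f) = Z f + smult (BI_omega3 r1 r2 \<rho>1 \<rho>2) f - Y (X f)"
  unfolding BI_X_refl_op BI_Z_refl_op refl_op_Y BI_omega3_def
  by (rule poly_ext) (simp add: BI_Y_def algebra_simps)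

text \<open>Only squares survive in \<open>{D\<^sub>\<rho> - D\<^sub>r, D\<^sub>\<rho> + D\<^sub>r} = 2 (D\<^sub>\<rho>\<^sup>2 - D\<^sub>r\<^sup>2)\<close>; no product of \<open>D\<^sub>\<rho>\<close> with
  \<open>D\<^sub>r\<close> has to be computed.\<close>

lemma BI_X_Z: "X (Z f) = Y f + smult (BI_omega2 r1 r2 \<rho>1 \<rho>2) f - Z (X f)"
  unfolding BI_X_refl_op BI_Z_refl_op refl_op_add refl_op_diff refl_op_square BI_omega2_def
  by (rule poly_ext) (simp add: BI_Y_def algebra_simps power2_eq_square)

section \<open>The ladder operators\<close>

text \<open>The sign \<open>\<epsilon> = \<plusminus>1\<close> treats both ladder operators at once: with \<open>W = Y + \<epsilon> Z\<close> and
  \<open>c = (\<omega>\<^sub>3 + \<epsilon> \<omega>\<^sub>2) / 2\<close>, the operator \<open>W (X - \<epsilon>/2) - c\<close> is \<open>J\<^sub>+\<close> for \<open>\<epsilon> = 1\<close> and \<open>J\<^sub>-\<close> for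
  \<open>\<epsilon> = - 1\<close>.\<close>

definition BI_W :: "real \<Rightarrow> real poly \<Rightarrow> real poly" where
  "BI_W \<epsilon> f = Y f + smult \<epsilon> (Z f)"

definition J_const :: "real \<Rightarrow> real" where
  "J_const \<epsilon> = (BI_omega3 r1 r2 \<rho>1 \<rho>2 + \<epsilon> * BI_omega2 r1 r2 \<rho>1 \<rho>2) / 2"

definition BI_J :: "real \<Rightarrow> real poly \<Rightarrow> real poly" where
  "BI_J \<epsilon> f = BI_W \<epsilon> (X f - smult (\<epsilon> / 2) f) - smult (J_const \<epsilon>) f"

lemma J_plus_eq_BI_J: "J_plus r1 r2 \<rho>1 \<rho>2 = BI_J 1"
  unfolding J_plus_def BI_J_def BI_W_def J_const_def Let_def fun_eq_iff
  by (simp add: add.commute)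

lemma J_minus_eq_BI_J: "J_minus r1 r2 \<rho>1 \<rho>2 = BI_J (- 1)"
proof
  fix f
  have c: "J_const (- 1) = - ((BI_omega2 r1 r2 \<rho>1 \<rho>2 - BI_omega3 r1 r2 \<rho>1 \<rho>2) / 2)"
    unfolding J_const_def by (simp add: field_simps)
  show "J_minus r1 r2 \<rho>1 \<rho>2 f = BI_J (- 1) f"
    unfolding J_minus_def BI_J_def BI_W_def Let_def c by simp
qed

lemma BI_W_diff: "BI_W \<epsilon> (f - g) = BI_W \<epsilon> f - BI_W \<epsilon> g"
  and BI_W_smult: "BI_W \<epsilon> (smult c f) = smult c (BI_W \<epsilon> f)"
  unfolding BI_W_def BI_Z_refl_op BI_Y_def refl_op_add refl_op_diff refl_op_smult
  by (simp_all add: algebra_simps smult_add_right smult_diff_right)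

lemma BI_J_smult: "BI_J \<epsilon> (smult c f) = smult c (BI_J \<epsilon> f)"
  unfolding BI_J_def BI_X_smult BI_W_diff BI_W_smult
  by (rule poly_ext) (simp add: algebra_simps)

lemma sign_cancel: "\<epsilon> * \<epsilon> = 1 \<Longrightarrow> \<epsilon> * (\<epsilon> * c) = (c :: real)"
  by (metis mult.assoc mult_1)

text \<open>Equivalently \<open>{X - \<epsilon>/2, W} = 2 c\<close>, which explains both shifts in the definition of \<open>J\<close>: with
  \<open>A = X - \<epsilon>/2\<close> it yields \<open>{A, W A - c} = 0\<close>.\<close>

lemma BI_X_W:
  assumes "\<epsilon> * \<epsilon> = 1"
  shows "X (BI_W \<epsilon> f) = smult \<epsilon> (BI_W \<epsilon> f) + smult (2 * J_const \<epsilon>) f - BI_W \<epsilon> (X f)"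
  unfolding BI_W_def BI_X_add BI_X_smult BI_X_Y BI_X_Z J_const_def
  using assms sign_cancel[OF assms] by (intro poly_ext) (simp add: field_simps)

lemma anticomm_X_J:
  assumes "\<epsilon> * \<epsilon> = 1"
  shows "X (BI_J \<epsilon> f) + BI_J \<epsilon> (X f) = smult \<epsilon> (BI_J \<epsilon> f)"
  unfolding BI_J_def BI_X_diff BI_X_smult BI_W_diff BI_W_smult BI_X_W[OF assms]
  using assms sign_cancel[OF assms] by (intro poly_ext) (simp add: algebra_simps)

text \<open>Since \<open>W\<^sup>2 = (X\<^sup>2 + Y\<^sup>2 + Z\<^sup>2) - X\<^sup>2 + \<epsilon> {Y, Z}\<close>, this combines two facts: the Casimir operator
  \<open>X\<^sup>2 + Y\<^sup>2 + Z\<^sup>2\<close> is the scalar \<open>2 (\<rho>\<^sub>1\<^sup>2 + \<rho>\<^sub>2\<^sup>2 + r\<^sub>1\<^sup>2 + r\<^sub>2\<^sup>2) - 1/4\<close>, and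
  \<open>{Y, Z} = X + 4 (\<rho>\<^sub>1 \<rho>\<^sub>2 + r\<^sub>1 r\<^sub>2)\<close>.  The subtracted operator is \<open>(X - \<epsilon>/2)\<^sup>2\<close>.\<close>

lemma BI_W_square:
  assumes "\<epsilon> * \<epsilon> = 1"
  shows "BI_W \<epsilon> (BI_W \<epsilon> f) =
    smult (2 * (\<rho>1 + \<epsilon> * \<rho>2)\<^sup>2 + 2 * (r1 + \<epsilon> * r2)\<^sup>2) f
    - (X (X f) - smult \<epsilon> (X f) + smult (1/4) f)"
proof -
  have Y_add: "Y (g + h) = Y g + Y h" and Y_smult: "Y (smult c g) = smult c (Y g)" for g h c
    by (simp_all add: BI_Y_def distrib_left mult_smult_right del: mult_pCons_left)
  show ?thesis
    unfolding BI_W_def BI_Z_refl_op BI_X_refl_op Y_add Y_smult refl_op_add refl_op_diff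
      refl_op_smult refl_op_Y refl_op_square
    by (rule poly_ext) (simp add: BI_Y_def algebra_simps power2_eq_square sign_cancel[OF assms])
qed

lemma BI_J_eigenvector:
  assumes \<epsilon>: "\<epsilon> * \<epsilon> = 1" and p: "X p = smult x p"
  shows "X (BI_J \<epsilon> p) = smult (\<epsilon> - x) (BI_J \<epsilon> p)"
proof -
  have "X (BI_J \<epsilon> p) = smult \<epsilon> (BI_J \<epsilon> p) - BI_J \<epsilon> (X p)"
    using anticomm_X_J[OF \<epsilon>, of p] by (simp add: algebra_simps)
  then show ?thesis
    by (simp add: p BI_J_smult smult_diff_left)
qed

lemma BI_J_on_eigenvector:
  assumes "X p = smult x p"
  shows "BI_J \<epsilon> p = smult (x - \<epsilon> / 2) (BI_W \<epsilon> p) - smult (J_const \<epsilon>) p"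
  unfolding BI_J_def assms by (simp only: smult_diff_left[symmetric] BI_W_smult)

text \<open>With \<open>A = X - \<epsilon>/2\<close> and \<open>W\<^sup>2 = K - A\<^sup>2\<close>, the relation \<open>A W = 2 c - W A\<close> gives
  \<open>J\<^sup>2 = c\<^sup>2 - (K - A\<^sup>2) A\<^sup>2\<close>.  With \<open>u, v = r\<^sub>1 + \<epsilon> r\<^sub>2 \<plusminus> (\<rho>\<^sub>1 + \<epsilon> \<rho>\<^sub>2)\<close> one has
  \<open>K = u\<^sup>2 + v\<^sup>2\<close> and \<open>c\<^sup>2 = u\<^sup>2 v\<^sup>2\<close>, hence the factorization.  On an eigenvector the computation is
  shorter, as \<open>J\<close> negates the eigenvalue of \<open>A\<close>.\<close>

lemma BI_J_square:
  assumes \<epsilon>: "\<epsilon> * \<epsilon> = 1" and p: "X p = smult x p"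
  shows "BI_J \<epsilon> (BI_J \<epsilon> p) = smult
    (((r1 + \<epsilon> * r2 + \<rho>1 + \<epsilon> * \<rho>2)\<^sup>2 - (x - \<epsilon> / 2)\<^sup>2)
     * ((r1 + \<epsilon> * r2 - \<rho>1 - \<epsilon> * \<rho>2)\<^sup>2 - (x - \<epsilon> / 2)\<^sup>2)) p"
proof -
  define a where "a = x - \<epsilon> / 2"
  define K where "K = 2 * (\<rho>1 + \<epsilon> * \<rho>2)\<^sup>2 + 2 * (r1 + \<epsilon> * r2)\<^sup>2"
  let ?c = "J_const \<epsilon>" and ?W = "BI_W \<epsilon>" and ?J = "BI_J \<epsilon>"
  have J: "?J p = smult a (?W p) - smult ?c p"
    unfolding a_def by (rule BI_J_on_eigenvector[OF p])
  have "\<epsilon> - x - \<epsilon> / 2 = - a"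
    unfolding a_def by simp
  then have JJ: "?J (?J p) = smult (- a) (?W (?J p)) - smult ?c (?J p)"
    using BI_J_on_eigenvector[OF BI_J_eigenvector[OF \<epsilon> p]] by metis
  have xa: "x * x - \<epsilon> * x + 1/4 = a * a"
    unfolding a_def using \<epsilon> by (simp add: field_simps)
  have WW: "?W (?W p) = smult (K - a * a) p"
    unfolding BI_W_square[OF \<epsilon>] K_def[symmetric] p BI_X_smult xa[symmetric]
    by (rule poly_ext) (simp add: algebra_simps)
  have "?J (?J p) = smult (?c * ?c - a * a * (K - a * a)) p"
    unfolding JJ unfolding J BI_W_diff BI_W_smult WW
    by (rule poly_ext) (simp add: algebra_simps)
  also have "?c * ?c - a * a * (K - a * a) =
      ((r1 + \<epsilon> * r2 + \<rho>1 + \<epsilon> * \<rho>2)\<^sup>2 - a\<^sup>2) * ((r1 + \<epsilon> * r2 - \<rho>1 - \<epsilon> * \<rho>2)\<^sup>2 - a\<^sup>2)"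
  proof -
    have c: "?c = \<epsilon> * ((\<rho>1 + \<epsilon> * \<rho>2)\<^sup>2 - (r1 + \<epsilon> * r2)\<^sup>2)"
      unfolding J_const_def BI_omega2_def BI_omega3_def using \<epsilon> by algebra
    show ?thesis
      unfolding c K_def using \<epsilon> by algebra
  qed
  finally show ?thesis unfolding a_def .
qed

section \<open>Raising the degree\<close>

definition X_eigenvalue :: "nat \<Rightarrow> real" where
  "X_eigenvalue n = (- 1) ^ n * (real n + 1/2 - s)"

lemma dunkl_L_eigen_iff:
  "dunkl_L r1 r2 \<rho>1 \<rho>2 p = smult (BI_eigenvalue r1 r2 \<rho>1 \<rho>2 n) p \<longleftrightarrow> X p = smult (X_eigenvalue n) p"
proof -
  have "X_eigenvalue n = 2 * BI_eigenvalue r1 r2 \<rho>1 \<rho>2 n + (\<rho>1 + \<rho>2 - r1 - r2 + 1/2)"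
    by (simp add: X_eigenvalue_def BI_eigenvalue_def field_simps)
  then show ?thesis
    unfolding BI_X_def by (simp add: smult_add_left poly_eq_iff)
qed

lemma X_eigenvalue_Suc: "X_eigenvalue (Suc n) = - ((- 1) ^ n) - X_eigenvalue n"
  by (simp add: X_eigenvalue_def algebra_simps)

lemma BI_X_one: "X 1 = smult (X_eigenvalue 0) 1"
  unfolding BI_X_refl_op refl_op_one X_eigenvalue_def by (rule poly_ext) simp

text \<open>The ladder relation alone does not force this: for \<open>s = 0\<close> the shifted eigenvalue coincides with
  the eigenvalue of \<open>1\<close>.\<close>

lemma BI_J_one: "BI_J 1 1 = 0"
  unfolding BI_J_on_eigenvector[OF BI_X_one] BI_W_def BI_Z_refl_op refl_op_one BI_Y_def
    J_const_def BI_omega2_def BI_omega3_def X_eigenvalue_def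
  by (rule poly_ext) (simp add: field_simps power2_eq_square)

text \<open>On a polynomial of degree \<open>n\<close> the leading terms of \<open>Y\<close> and \<open>\<epsilon> Z\<close> are \<open>2x\<close> and
  \<open>- 2 \<epsilon> (- 1)\<^sup>n x\<close>; the sign \<open>\<epsilon> = - (- 1)\<^sup>n\<close> is the one for which they do not cancel.\<close>

lemma BI_W_lead:
  assumes "degree p = n" "lead_coeff p = 1"
  shows "degree (BI_W (- ((- 1) ^ n)) p) \<le> Suc n" "coeff (BI_W (- ((- 1) ^ n)) p) (Suc n) = 4"
proof -
  have nz: "p \<noteq> 0" using assms by auto
  note D\<rho> = refl_op_lead[OF nz, of 0 \<rho>1 \<rho>2] and Dr = refl_op_lead[OF nz, of "1/2" r1 r2]
  show "degree (BI_W (- ((- 1) ^ n)) p) \<le> Suc n"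
    unfolding BI_W_def BI_Z_refl_op
  proof (intro degree_add_le order.trans[OF degree_smult_le])
    show "degree (Y p) \<le> Suc n"
      unfolding BI_Y_def using degree_mult_le[of "[:1/2, 2:]" p] assms by simp
  qed (use D\<rho> Dr assms in simp_all)
  have "coeff p (Suc n) = 0"
    using assms by (intro coeff_eq_0) simp
  then show "coeff (BI_W (- ((- 1) ^ n)) p) (Suc n) = 4"
    using D\<rho> Dr assms by (simp add: BI_W_def BI_Z_refl_op BI_Y_def flip: power_mult_distrib)
qed

text \<open>The factor \<open>s - (n + 1)\<close> comes from the eigenvalue of \<open>X - \<epsilon>/2\<close>, the factor \<open>4\<close> from the leading
  coefficient of \<open>W\<close>.  Starting from the constant \<open>1\<close> this constructs all eigenpolynomials.\<close>

lemma BI_J_raises_eigenpoly: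
  assumes p: "degree p = n" "lead_coeff p = 1" "X p = smult (X_eigenvalue n) p"
    and nz: "s \<noteq> real (Suc n)"
  defines "\<epsilon> \<equiv> - ((- 1) ^ n)"
  defines "k \<equiv> 4 * \<epsilon> * (s - real (Suc n))"
  obtains q where "BI_J \<epsilon> p = smult k q" "degree q = Suc n" "lead_coeff q = 1"
    "X q = smult (X_eigenvalue (Suc n)) q"
proof
  have \<epsilon>: "\<epsilon> * \<epsilon> = 1"
    unfolding \<epsilon>_def by (simp flip: power_mult_distrib)
  have k0: "k \<noteq> 0"
    using nz \<epsilon> unfolding k_def by auto
  have a: "4 * (X_eigenvalue n - \<epsilon> / 2) = k"
    unfolding k_def \<epsilon>_def X_eigenvalue_def by (simp add: algebra_simps)
  have J: "BI_J \<epsilon> p = smult (X_eigenvalue n - \<epsilon> / 2) (BI_W \<epsilon> p) - smult (J_const \<epsilon>) p"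
    by (rule BI_J_on_eigenvector[OF p(3)])
  note W = BI_W_lead[OF p(1,2), folded \<epsilon>_def]
  have le: "degree (BI_J \<epsilon> p) \<le> Suc n"
    unfolding J using W(1) p(1)
    by (intro degree_diff_le order.trans[OF degree_smult_le]) auto
  have "coeff p (Suc n) = 0"
    using p(1) by (intro coeff_eq_0) simp
  then have lc: "coeff (BI_J \<epsilon> p) (Suc n) = k"
    unfolding J using W(2) a by simp
  define q where "q = smult (1 / k) (BI_J \<epsilon> p)"
  show "BI_J \<epsilon> p = smult k q"
    unfolding q_def using k0 by simp
  have deg: "degree (BI_J \<epsilon> p) = Suc n"
    using le lc k0 by (intro antisym le_degree) auto
  then show "degree q = Suc n" "lead_coeff q = 1"
    unfolding q_def using k0 lc by simp_all
  show "X q = smult (X_eigenvalue (Suc n)) q"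
    unfolding q_def BI_X_smult BI_J_eigenvector[OF \<epsilon> p(3)] X_eigenvalue_Suc \<epsilon>_def[symmetric]
    by (simp add: mult.commute)
qed

section \<open>Bannai-Ito polynomials\<close>

lemma degree_cancel_lead:
  fixes p q :: "real poly"
  assumes "degree p \<le> n" "degree q = n" "lead_coeff q = 1"
  shows "p = smult (coeff p n) q \<or> degree (p - smult (coeff p n) q) < n"
proof (cases "n = 0")
  case True
  then show ?thesis using assms by (auto elim!: degree_eq_zeroE)
next
  case False
  have "coeff (p - smult (coeff p n) q) n = 0" using assms by simp
  moreover have "degree (p - smult (coeff p n) q) \<le> n"
    using assms by (intro degree_diff_le order.trans[OF degree_smult_le]) auto
  ultimately show ?thesis
    using False by (metis eq_zero_or_degree_less eq_iff_diff_eq_0)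
qed

context
  assumes s_not_pos_int: "\<And>k::nat. k \<ge> 1 \<Longrightarrow> s \<noteq> real k"
begin

lemma BI_eigenpoly_exists:
  "\<exists>p. lead_coeff p = 1 \<and> degree p = n \<and> X p = smult (X_eigenvalue n) p"
proof (induction n)
  case 0
  show ?case using BI_X_one by (intro exI[of _ 1]) simp
next
  case (Suc n)
  then obtain p where p: "degree p = n" "lead_coeff p = 1" "X p = smult (X_eigenvalue n) p"
    by blast
  have "s \<noteq> real (Suc n)" by (rule s_not_pos_int) simp
  from BI_J_raises_eigenpoly[OF p this] show ?case by metis
qed

text \<open>For indices of different parity an equality would give \<open>2 s = m + n + 1\<close>, an even positive
  number, so \<open>s\<close> would be a positive integer.\<close>

lemma X_eigenvalue_inj:
  assumes "X_eigenvalue m = X_eigenvalue n"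
  shows "m = n"
proof (cases "even m \<longleftrightarrow> even n")
  case True
  then have "(- 1 :: real) ^ m = (- 1) ^ n"
    by (auto simp: minus_one_power_iff)
  then show ?thesis using assms by (simp add: X_eigenvalue_def)
next
  case False
  then have "even (m + n + 1)" by simp
  then obtain k where k: "m + n + 1 = 2 * k" by blast
  have "(- 1 :: real) ^ m = - ((- 1) ^ n)"
    using False by (auto simp: minus_one_power_iff)
  then have "2 * s = real (m + n + 1)"
    using assms by (simp add: X_eigenvalue_def minus_one_power_iff split: if_splits)
  then have "s = real k" unfolding k by simp
  moreover have "k \<ge> 1" using k by linarith
  ultimately show ?thesis using s_not_pos_int by blast
qed

text \<open>The eigenpolynomials already constructed have every degree, so they form a basis adapted to the
  degree filtration, and \<open>X\<close> is diagonal in it.  This replaces an expansion of \<open>L x\<^sup>n\<close>.\<close>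

lemma BI_X_triangular:
  assumes "degree p \<le> n"
  shows "degree (X p) \<le> n \<and> coeff (X p) n = X_eigenvalue n * coeff p n"
  using assms
proof (induction n arbitrary: p rule: less_induct)
  case (less n)
  obtain q where q: "lead_coeff q = 1" "degree q = n" "X q = smult (X_eigenvalue n) q"
    using BI_eigenpoly_exists by blast
  define c where "c = coeff p n"
  define r where "r = p - smult c q"
  have p: "p = smult c q + r" unfolding r_def by simp
  have "degree (X r) \<le> n \<and> coeff (X r) n = 0"
    using degree_cancel_lead[OF less.prems q(2,1)]
  proof
    assume "p = smult (coeff p n) q"
    then have "r = smult 0 q" unfolding r_def c_def by simp
    then have "X r = smult 0 (X q)" by (simp only: BI_X_smult)
    then show ?thesis by simp
  next
    assume "degree (p - smult (coeff p n) q) < n"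
    then have lt: "degree r < n" unfolding r_def c_def .
    then have "degree (X r) \<le> degree r" using less.IH by blast
    then show ?thesis using lt by (auto intro: coeff_eq_0)
  qed
  moreover have "X p = smult (c * X_eigenvalue n) q + X r"
    unfolding p BI_X_add BI_X_smult by (simp add: q)
  ultimately show ?case
    using q by (auto intro!: degree_add_le order.trans[OF degree_smult_le] simp: c_def)
qed

lemma BI_eigenvector_degree:
  assumes "X p = smult (X_eigenvalue n) p" "p \<noteq> 0"
  shows "degree p = n"
proof -
  have "X_eigenvalue n * lead_coeff p = X_eigenvalue (degree p) * lead_coeff p"
    using BI_X_triangular[of p "degree p"] assms by simp
  then show ?thesis using assms X_eigenvalue_inj by simp
qed

text \<open>Subtracting a multiple of \<open>q\<close> leaves an eigenvector for the same eigenvalue but of smaller degree,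
  which must vanish because the degree of an eigenvector is determined by its eigenvalue.\<close>

lemma BI_eigenspace:
  assumes q: "lead_coeff q = 1" "degree q = n" "X q = smult (X_eigenvalue n) q"
    and p: "X p = smult (X_eigenvalue n) p"
  shows "p = smult (coeff p n) q"
proof (rule ccontr)
  assume ne: "p \<noteq> smult (coeff p n) q"
  have "degree p \<le> n"
    using BI_eigenvector_degree[OF p] by (cases "p = 0") auto
  then have "degree (p - smult (coeff p n) q) < n"
    using degree_cancel_lead q ne by blast
  moreover have "X (p - smult (coeff p n) q) = smult (X_eigenvalue n) (p - smult (coeff p n) q)"
    by (simp add: BI_X_diff BI_X_smult p q smult_diff_right mult.commute)
  ultimately show False
    using BI_eigenvector_degree ne by (metis eq_iff_diff_eq_0 less_irrefl)
qed

lemma BI_poly_eqI: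
  assumes "lead_coeff q = 1" "degree q = n" "X q = smult (X_eigenvalue n) q"
  shows "BI_poly r1 r2 \<rho>1 \<rho>2 n = q"
  unfolding BI_poly_def dunkl_L_eigen_iff
proof (rule the_equality)
  show "lead_coeff q = 1 \<and> degree q = n \<and> X q = smult (X_eigenvalue n) q"
    using assms by simp
next
  fix p assume "lead_coeff p = 1 \<and> degree p = n \<and> X p = smult (X_eigenvalue n) p"
  then show "p = q" using BI_eigenspace[OF assms, of p] by auto
qed

lemma BI_poly_eigen:
  shows "lead_coeff (BI_poly r1 r2 \<rho>1 \<rho>2 n) = 1"
    and "degree (BI_poly r1 r2 \<rho>1 \<rho>2 n) = n"
    and "X (BI_poly r1 r2 \<rho>1 \<rho>2 n) = smult (X_eigenvalue n) (BI_poly r1 r2 \<rho>1 \<rho>2 n)"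
  using BI_eigenpoly_exists[of n] BI_poly_eqI by metis+

lemma BI_J_raising:
  "BI_J (- ((- 1) ^ n)) (BI_poly r1 r2 \<rho>1 \<rho>2 n) =
     smult (4 * (- ((- 1) ^ n)) * (s - real (Suc n))) (BI_poly r1 r2 \<rho>1 \<rho>2 (Suc n))"
proof -
  have "s \<noteq> real (Suc n)" by (rule s_not_pos_int) simp
  from BI_J_raises_eigenpoly[OF BI_poly_eigen(2,1,3) this] show ?thesis
    using BI_poly_eqI by metis
qed

text \<open>Here \<open>J\<close> with sign \<open>\<epsilon>\<close> raises \<open>P\<^sub>n\<close> to \<open>k P\<^sub>n\<^sub>+\<^sub>1\<close>, so applying \<open>J\<close> to \<open>P\<^sub>n\<^sub>+\<^sub>1\<close> gives \<open>J\<^sup>2 P\<^sub>n / k\<close>,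
  which is known.  This avoids computing subleading
  coefficients.\<close>

lemma BI_J_lowering:
  fixes n :: nat
  defines "\<epsilon> \<equiv> - ((- 1) ^ n)"
  shows "BI_J \<epsilon> (BI_poly r1 r2 \<rho>1 \<rho>2 (Suc n)) = smult
     (((r1 + \<epsilon> * r2 + \<rho>1 + \<epsilon> * \<rho>2)\<^sup>2 - (s - real (Suc n))\<^sup>2)
      * ((r1 + \<epsilon> * r2 - \<rho>1 - \<epsilon> * \<rho>2)\<^sup>2 - (s - real (Suc n))\<^sup>2)
      / (4 * \<epsilon> * (s - real (Suc n)))) (BI_poly r1 r2 \<rho>1 \<rho>2 n)"
proof -
  let ?P = "BI_poly r1 r2 \<rho>1 \<rho>2" and ?k = "4 * \<epsilon> * (s - real (Suc n))"
  have \<epsilon>: "\<epsilon> * \<epsilon> = 1"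
    unfolding \<epsilon>_def by (simp flip: power_mult_distrib)
  have "s \<noteq> real (Suc n)" by (rule s_not_pos_int) simp
  then have k0: "?k \<noteq> 0" using \<epsilon> by auto
  have x: "(X_eigenvalue n - \<epsilon> / 2)\<^sup>2 = (s - real (Suc n))\<^sup>2"
  proof -
    have "X_eigenvalue n - \<epsilon> / 2 = \<epsilon> * (s - real (Suc n))"
      unfolding X_eigenvalue_def \<epsilon>_def by (simp add: algebra_simps)
    then show ?thesis using \<epsilon> by (simp add: power_mult_distrib power2_eq_square)
  qed
  have "smult ?k (BI_J \<epsilon> (?P (Suc n))) = BI_J \<epsilon> (BI_J \<epsilon> (?P n))"
    using BI_J_raising[of n] unfolding \<epsilon>_def by (simp only: BI_J_smult)
  also have "\<dots> = smult (((r1 + \<epsilon> * r2 + \<rho>1 + \<epsilon> * \<rho>2)\<^sup>2 - (s - real (Suc n))\<^sup>2)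
      * ((r1 + \<epsilon> * r2 - \<rho>1 - \<epsilon> * \<rho>2)\<^sup>2 - (s - real (Suc n))\<^sup>2)) (?P n)"
    unfolding BI_J_square[OF \<epsilon> BI_poly_eigen(3)] x ..
  finally have "smult (1 / ?k) (smult ?k (BI_J \<epsilon> (?P (Suc n)))) = smult (1 / ?k) (smult 
      (((r1 + \<epsilon> * r2 + \<rho>1 + \<epsilon> * \<rho>2)\<^sup>2 - (s - real (Suc n))\<^sup>2)
      * ((r1 + \<epsilon> * r2 - \<rho>1 - \<epsilon> * \<rho>2)\<^sup>2 - (s - real (Suc n))\<^sup>2)) (?P n))"
    by (rule arg_cong)
  then show ?thesis using k0 by simp
qed

end

end

section \<open>The structure relations\<close>

theorem mainTheorem6:
  fixes r1 r2 \<rho>1 \<rho>2 :: real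
  assumes "\<And>k::nat. k \<ge> 1 \<Longrightarrow> r1 + r2 - \<rho>1 - \<rho>2 \<noteq> real k"
  shows "anticomm (BI_X r1 r2 \<rho>1 \<rho>2) (J_plus r1 r2 \<rho>1 \<rho>2) = J_plus r1 r2 \<rho>1 \<rho>2
    \<and> anticomm (BI_X r1 r2 \<rho>1 \<rho>2) (J_minus r1 r2 \<rho>1 \<rho>2) = (\<lambda>f. - J_minus r1 r2 \<rho>1 \<rho>2 f)
    \<and> J_plus r1 r2 \<rho>1 \<rho>2 (BI_poly r1 r2 \<rho>1 \<rho>2 0) = 0
    \<and> (\<forall>n. even n \<and> n \<ge> 2 \<longrightarrow> J_plus r1 r2 \<rho>1 \<rho>2 (BI_poly r1 r2 \<rho>1 \<rho>2 n)
          = smult (alpha0 r1 r2 \<rho>1 \<rho>2 n) (BI_poly r1 r2 \<rho>1 \<rho>2 (n - 1)))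
    \<and> (\<forall>n. odd n \<longrightarrow> J_plus r1 r2 \<rho>1 \<rho>2 (BI_poly r1 r2 \<rho>1 \<rho>2 n)
          = smult (alpha1 r1 r2 \<rho>1 \<rho>2 n) (BI_poly r1 r2 \<rho>1 \<rho>2 (n + 1)))
    \<and> (\<forall>n. even n \<longrightarrow> J_minus r1 r2 \<rho>1 \<rho>2 (BI_poly r1 r2 \<rho>1 \<rho>2 n)
          = smult (beta0 r1 r2 \<rho>1 \<rho>2 n) (BI_poly r1 r2 \<rho>1 \<rho>2 (n + 1)))
    \<and> (\<forall>n. odd n \<longrightarrow> J_minus r1 r2 \<rho>1 \<rho>2 (BI_poly r1 r2 \<rho>1 \<rho>2 n)
          = smult (beta1 r1 r2 \<rho>1 \<rho>2 n) (BI_poly r1 r2 \<rho>1 \<rho>2 (n - 1)))"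
proof -
  let ?P = "BI_poly r1 r2 \<rho>1 \<rho>2" and ?J = "BI_J r1 r2 \<rho>1 \<rho>2"
  note J_eq = J_plus_eq_BI_J J_minus_eq_BI_J
  have "anticomm (BI_X r1 r2 \<rho>1 \<rho>2) (?J 1) = ?J 1"
    and "anticomm (BI_X r1 r2 \<rho>1 \<rho>2) (?J (- 1)) = (\<lambda>f. - ?J (- 1) f)"
    unfolding anticomm_def fun_eq_iff by (simp_all add: anticomm_X_J)
  moreover have "?J 1 (?P 0) = 0"
  proof -
    have "?P 0 = 1"
      by (rule BI_poly_eqI[OF assms]) (simp_all add: BI_X_one)
    then show ?thesis by (simp add: BI_J_one)
  qed
  moreover have "?J 1 (?P n) = smult (alpha0 r1 r2 \<rho>1 \<rho>2 n) (?P (n - 1))"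
    if n: "even n" "n \<ge> 2" for n
  proof -
    obtain m where m: "n = Suc m" "odd m" using n by (cases n) auto
    have "((r1 + r2 + \<rho>1 + \<rho>2)\<^sup>2 - (r1 + r2 - \<rho>1 - \<rho>2 - real n)\<^sup>2)
        * ((r1 + r2 - \<rho>1 - \<rho>2)\<^sup>2 - (r1 + r2 - \<rho>1 - \<rho>2 - real n)\<^sup>2) =
        4 * (2 * real n * (\<rho>1 + \<rho>2 + real n / 2) * (r1 + r2 - real n / 2)
          * (r1 + r2 - \<rho>1 - \<rho>2 - real n / 2))"
      by (simp add: field_simps power2_eq_square)
    then have "alpha0 r1 r2 \<rho>1 \<rho>2 n =
        ((r1 + r2 + \<rho>1 + \<rho>2)\<^sup>2 - (r1 + r2 - \<rho>1 - \<rho>2 - real n)\<^sup>2)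
        * ((r1 + r2 - \<rho>1 - \<rho>2)\<^sup>2 - (r1 + r2 - \<rho>1 - \<rho>2 - real n)\<^sup>2)
        / (4 * (r1 + r2 - \<rho>1 - \<rho>2 - real n))"
      by (simp only: alpha0_def mult_divide_mult_cancel_left_if) simp
    then show ?thesis
      using BI_J_lowering[OF assms, of m] m by simp
  qed
  moreover have "?J 1 (?P n) = smult (alpha1 r1 r2 \<rho>1 \<rho>2 n) (?P (n + 1))" if "odd n" for n
    using BI_J_raising[OF assms, of n] that by (simp add: alpha1_def algebra_simps)
  moreover have "?J (- 1) (?P n) = smult (beta0 r1 r2 \<rho>1 \<rho>2 n) (?P (n + 1))" if "even n" for n
    using BI_J_raising[OF assms, of n] that by (simp add: beta0_def algebra_simps)
  moreover have "?J (- 1) (?P n) = smult (beta1 r1 r2 \<rho>1 \<rho>2 n) (?P (n - 1))" if n: "odd n" for n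
  proof -
    obtain m where m: "n = Suc m" "even m" using n by (cases n) auto
    have "((r1 - r2 + \<rho>1 - \<rho>2)\<^sup>2 - (r1 + r2 - \<rho>1 - \<rho>2 - real n)\<^sup>2)
        * ((r1 - r2 - \<rho>1 + \<rho>2)\<^sup>2 - (r1 + r2 - \<rho>1 - \<rho>2 - real n)\<^sup>2) =
        4 * (4 * (\<rho>1 - r1 + real n / 2) * (\<rho>1 - r2 + real n / 2)
          * (\<rho>2 - r1 + real n / 2) * (\<rho>2 - r2 + real n / 2))"
      by (simp add: field_simps power2_eq_square)
    moreover have "- 4 * (r1 + r2 - \<rho>1 - \<rho>2 - real n) = 4 * (\<rho>1 + \<rho>2 - r1 - r2 + real n)"
      by simp
    ultimately have "beta1 r1 r2 \<rho>1 \<rho>2 n =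
        ((r1 - r2 + \<rho>1 - \<rho>2)\<^sup>2 - (r1 + r2 - \<rho>1 - \<rho>2 - real n)\<^sup>2)
        * ((r1 - r2 - \<rho>1 + \<rho>2)\<^sup>2 - (r1 + r2 - \<rho>1 - \<rho>2 - real n)\<^sup>2)
        / (- 4 * (r1 + r2 - \<rho>1 - \<rho>2 - real n))"
      by (simp only: beta1_def mult_divide_mult_cancel_left_if) simp
    then show ?thesis
      using BI_J_lowering[OF assms, of m] m by simp
  qed
  ultimately show ?thesis
    unfolding J_eq by blast
qed

end
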